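(* Let $G$ be a finite simple undirected connected graph with $n$ vertices and $m\ge 1$ edges, let $\mu$ be the largest eigenvalue of its adjacency matrix, let $\beta=\frac{\mu n}{2m}$, and let $\lambda(G)$ be the Colin de Verdière parameter of $G$. Then $$\lambda(G)\le \frac{n}{\beta}-1=\frac{2m}{\mu}-1.$$
   Context: The quantity $\beta = \mu/d=\frac{\mu n}{2m}$, where $d=2m/n$ is the average degree, is a spectral measure of the irregularity of $G$; it is defined for graphs with at least one edge. The Colin de Verdière parameter $\lambda(G)$ (usually denoted $\mu(G)$ in the literature) of a graph $G$ on vertex set $\{1,\dots,n\}$ is the largest corank (dimension of the kernel) of a real symmetric $n\times n$ matrix $M=(M_{ij})$ such that: (1) for all $i\ne j$, $M_{ij}<0$ if $i$ and $j$ are adjacent and $M_{ij}=0$ if $i$ and $j$ are not adjacent (the diagonal entries are arbitrary); (2) $M$ has exactly one negative eigenvalue, and it has multiplicity $1$; (3) (Strong Arnold Property) there is no nonzero real symmetric $n\times n$ matrix $X=(X_{ij})$ with $MX=0$ and with $X_{ij}=0$ whenever $i=j$ or $M_{ij}\neq 0$. *)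

theory Defs
  imports "HOL-Analysis.Analysis"
begin

text \<open>
  A simple undirected graph is given by its edge set, a set of two-element sets of vertices.
  Every element of the finite type \<open>'v\<close> is a vertex, so the number of vertices is
  \<open>CARD('v)\<close>, and matrices indexed by vertices have type \<open>real ^ 'v ^ 'v\<close>.
\<close>

definition simple_graph :: "'v::finite set set \<Rightarrow> bool" where
  "simple_graph E \<longleftrightarrow> (\<forall>e\<in>E. card e = 2)"

definition connected_graph :: "'v::finite set set \<Rightarrow> bool" where
  "connected_graph E \<longleftrightarrow> (\<forall>u v. (u, v) \<in> {(a, b). {a, b} \<in> E}\<^sup>*)"

definition adjacency_matrix :: "'v::finite set set \<Rightarrow> real ^ 'v ^ 'v" where
  "adjacency_matrix E = (\<chi> i j. if {i, j} \<in> E then 1 else 0)"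

definition eigenspace :: "real ^ 'v ^ 'v \<Rightarrow> real \<Rightarrow> (real ^ 'v::finite) set" where
  "eigenspace M c = {x. M *v x = c *\<^sub>R x}"

definition eigenvalue :: "real ^ 'v ^ 'v::finite \<Rightarrow> real \<Rightarrow> bool" where
  "eigenvalue M c \<longleftrightarrow> (\<exists>x. x \<noteq> 0 \<and> M *v x = c *\<^sub>R x)"

text \<open>
  The maximum is taken over a finite nonempty set, since a real symmetric matrix has a real
  eigenvalue and at most \<open>CARD('v)\<close> of them.
\<close>

definition largest_adjacency_eigenvalue :: "'v::finite set set \<Rightarrow> real" where
  "largest_adjacency_eigenvalue E = Max {c. eigenvalue (adjacency_matrix E) c}"

text \<open>
  The quotient of the largest eigenvalue by the average degree; meaningful if \<open>E\<close> is nonempty.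
\<close>

definition spectral_irregularity :: "'v::finite set set \<Rightarrow> real" where
  "spectral_irregularity E =
     largest_adjacency_eigenvalue E / (2 * real (card E) / real CARD('v))"

definition corank :: "real ^ 'v ^ 'v::finite \<Rightarrow> nat" where
  "corank M = dim {x. M *v x = 0}"

definition strong_arnold_property :: "real ^ 'v ^ 'v::finite \<Rightarrow> bool" where
  "strong_arnold_property M \<longleftrightarrow>
     \<not> (\<exists>X :: real ^ 'v ^ 'v. X \<noteq> 0 \<and> transpose X = X \<and> M ** X = 0 \<and>
          (\<forall>i j. i = j \<or> M $ i $ j \<noteq> 0 \<longrightarrow> X $ i $ j = 0))"

text \<open>
  The multiplicity of an eigenvalue is the dimension of its eigenspace; the matrices concerned
  are symmetric, so this is also its multiplicity as a root of the characteristic polynomial.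
\<close>

definition colin_de_verdiere_matrix ::
    "'v::finite set set \<Rightarrow> real ^ 'v ^ 'v \<Rightarrow> bool" where
  "colin_de_verdiere_matrix E M \<longleftrightarrow>
     transpose M = M \<and>
     (\<forall>i j. i \<noteq> j \<longrightarrow>
        ({i, j} \<in> E \<longrightarrow> M $ i $ j < 0) \<and> ({i, j} \<notin> E \<longrightarrow> M $ i $ j = 0)) \<and>
     (\<exists>c. {a. a < 0 \<and> eigenvalue M a} = {c} \<and> dim (eigenspace M c) = 1) \<and>
     strong_arnold_property M"

text \<open>
  The maximum is taken over a set of numbers that are at most \<open>CARD('v)\<close>. The set is nonempty:
  every graph admits a nonsingular matrix with exactly one negative eigenvalue, of multiplicity
  one, and the required sign pattern, and the strong Arnold property is trivial for it.
\<close>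

definition colin_de_verdiere :: "'v::finite set set \<Rightarrow> nat" where
  "colin_de_verdiere E = Max {corank M | M. colin_de_verdiere_matrix E M}"

end

theory Submission imports Defs begin

text \<open>
  Let \<open>M\<close> attain \<open>\<lambda>(G) = k\<close>. The symmetric matrices \<open>X\<close> with \<open>M X = 0\<close> form a space of dimension
  \<open>k (k + 1) / 2\<close>. By the strong Arnold property they are determined by their \<open>n + m\<close> entries on the
  diagonal and the edges, and these entries are orthogonal to all \<open>D M + M D\<close> with \<open>D\<close> diagonal. If the
  latter form a space of dimension \<open>n\<close>, then \<open>k (k + 1) \<le> 2 m\<close>, which together with Stanley's bound
  \<open>\<mu> (\<mu> + 1) \<le> 2 m\<close> yields \<open>\<mu> (k + 1) \<le> 2 m\<close>. Otherwise the dimension is \<open>n - 1\<close>, \<open>M\<close> has zero diagonal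
  and \<open>G\<close> is bipartite; then \<open>\<mu>\<^sup>2 \<le> m\<close> and \<open>k (k + 1) \<le> 2 m + 2\<close>, which suffices unless \<open>k = m = 2\<close>, and
  this is excluded because a path on three vertices with zero diagonal has corank at most one.
\<close>

section \<open>Quadratic forms and eigenvectors of symmetric matrices\<close>

lemma symmetric_matrix_inner:
  fixes M :: "real ^ 'n ^ 'n"
  assumes "transpose M = M"
  shows "(M *v x) \<bullet> y = x \<bullet> (M *v y)"
  by (metis assms dot_lmul_matrix transpose_matrix_vector)

lemma inner_matrix_vector_eq_sum:
  fixes M :: "real ^ 'n ^ 'n"
  shows "x \<bullet> (M *v x) = (\<Sum>i\<in>UNIV. \<Sum>j\<in>UNIV. M $ i $ j * x $ i * x $ j)"
  by (simp add: inner_vec_def matrix_vector_mult_def sum_distrib_left mult_ac)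

text \<open>With \<open>y = M *v x\<close>, the form at \<open>x + t *\<^sub>R y\<close> is
  \<open>2 * t * (y \<bullet> y)\<close> plus a term of order \<open>t\<^sup>2\<close>, so a small
  negative \<open>t\<close> would make it negative unless \<open>y = 0\<close>.\<close>

lemma psd_form_zero_imp_kernel:
  fixes M :: "real ^ 'n ^ 'n"
  assumes "transpose M = M" and psd: "\<And>y. 0 \<le> y \<bullet> (M *v y)" and "x \<bullet> (M *v x) = 0"
  shows "M *v x = 0"
proof -
  define y where "y = M *v x"
  define q where "q = y \<bullet> (M *v y)"
  have q: "q \<ge> 0" unfolding q_def by (rule psd)
  have xy: "x \<bullet> (M *v y) = y \<bullet> y"
    by (simp add: y_def symmetric_matrix_inner[OF assms(1), symmetric])
  have *: "0 \<le> 2 * t * (y \<bullet> y) + t\<^sup>2 * q" for t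
  proof -
    have "(x + t *\<^sub>R y) \<bullet> (M *v (x + t *\<^sub>R y)) = 2 * t * (y \<bullet> y) + t\<^sup>2 * q"
      using assms(3) xy unfolding y_def[symmetric]
      by (simp add: y_def[symmetric] q_def power2_eq_square algebra_simps)
    with psd[of "x + t *\<^sub>R y"] show ?thesis by simp
  qed
  have "y \<bullet> y = 0"
  proof (rule ccontr)
    assume "y \<bullet> y \<noteq> 0"
    then have pos: "y \<bullet> y > 0" using inner_ge_zero[of y] by linarith
    \<comment> \<open>Nearly the minimiser of the quadratic polynomial; \<open>q + 1\<close> in
      place of \<open>q\<close> keeps the denominator positive when \<open>q = 0\<close>.\<close>
    define t where "t = - (y \<bullet> y) / (q + 1)"
    have t: "t * (q + 1) = - (y \<bullet> y)" using q by (simp add: t_def)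
    have "t < 0" using q pos by (simp add: t_def divide_simps)
    have "2 * t * (y \<bullet> y) + t\<^sup>2 * q = t * (2 * (y \<bullet> y) + (t * (q + 1) - t))"
      by (simp add: power2_eq_square algebra_simps)
    also have "\<dots> = t * ((y \<bullet> y) - t)" by (simp add: t)
    also have "\<dots> < 0" using \<open>t < 0\<close> pos by (intro mult_neg_pos) linarith+
    finally show False using *[of t] by simp
  qed
  then show ?thesis by (simp add: y_def)
qed

text \<open>A maximiser of the form on the compact unit sphere works: with \<open>c\<close> the
  maximum, the form of \<open>c\<close> times the identity minus \<open>M\<close> is nonnegative and
  vanishes at the maximiser, which therefore lies in the kernel of that matrix.\<close>

lemma symmetric_matrix_max_eigenvector:
  fixes M :: "real ^ 'n ^ 'n"
  assumes "transpose M = M"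
  obtains x c where "x \<noteq> 0" "M *v x = c *\<^sub>R x" "\<And>y. y \<bullet> (M *v y) \<le> c * (y \<bullet> y)"
proof -
  have "\<exists>x\<in>sphere 0 1. \<forall>y\<in>sphere 0 1. y \<bullet> (M *v y) \<le> x \<bullet> (M *v x)"
  proof (rule continuous_attains_sup)
    show "sphere (0 :: real ^ 'n) 1 \<noteq> {}" by simp
    show "continuous_on (sphere 0 1) (\<lambda>x. x \<bullet> (M *v x))"
      by (intro continuous_intros matrix_vector_mult_linear_continuous_on)
  qed simp
  then obtain x where x: "norm x = 1"
    and max: "\<And>y. norm y = 1 \<Longrightarrow> y \<bullet> (M *v y) \<le> x \<bullet> (M *v x)" by auto
  define c where "c = x \<bullet> (M *v x)"
  have le: "y \<bullet> (M *v y) \<le> c * (y \<bullet> y)" for y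
  proof (cases "y = 0")
    case False
    define u where "u = (1 / norm y) *\<^sub>R y"
    have "norm u = 1" using False by (simp add: u_def)
    then have "u \<bullet> (M *v u) \<le> c" unfolding c_def by (rule max)
    moreover have "u \<bullet> (M *v u) = (y \<bullet> (M *v y)) / (norm y)\<^sup>2"
      by (simp add: u_def matrix_vector_mult_scaleR power2_eq_square)
    ultimately show ?thesis
      using False by (simp add: divide_simps dot_square_norm)
  qed simp
  define N where "N = c *\<^sub>R mat 1 - M"
  have N: "N *v y = c *\<^sub>R y - M *v y" for y
    by (simp add: N_def matrix_vector_mult_diff_rdistrib scaleR_matrix_vector_assoc[symmetric])
  have "N *v x = 0"
  proof (rule psd_form_zero_imp_kernel)
    show "transpose N = N"
      using assms by (simp add: N_def transpose_def vec_eq_iff mat_def)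
    show "0 \<le> y \<bullet> (N *v y)" for y using le[of y] by (simp add: N inner_diff_right)
    show "x \<bullet> (N *v x) = 0"
      using x by (simp add: N inner_diff_right c_def dot_square_norm)
  qed
  then have "M *v x = c *\<^sub>R x" by (simp add: N)
  moreover have "x \<noteq> 0" using x by auto
  ultimately show ?thesis using that le by blast
qed

lemma symmetric_eigenvectors_orthogonal:
  fixes M :: "real ^ 'n ^ 'n"
  assumes "transpose M = M" "M *v x = a *\<^sub>R x" "M *v y = b *\<^sub>R y" "a \<noteq> b"
  shows "x \<bullet> y = 0"
proof -
  have "a * (x \<bullet> y) = b * (x \<bullet> y)"
    using symmetric_matrix_inner[OF assms(1), of x y] assms(2,3) by simp
  with assms(4) show ?thesis by simp
qed

text \<open>Eigenvectors for distinct eigenvalues are orthogonal, hence independent. Finiteness is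
  what gives \<open>Max\<close> in the definition of the largest adjacency eigenvalue its
  meaning.\<close>

lemma finite_eigenvalues:
  fixes M :: "real ^ 'n ^ 'n"
  assumes "transpose M = M"
  shows "finite {c. eigenvalue M c}"
proof -
  define f where "f c = (SOME x. x \<noteq> 0 \<and> M *v x = c *\<^sub>R x)" for c
  have f: "f c \<noteq> 0 \<and> M *v f c = c *\<^sub>R f c" if "eigenvalue M c" for c
    using that unfolding f_def eigenvalue_def by (rule someI_ex)
  have orth: "f a \<bullet> f b = 0" if "eigenvalue M a" "eigenvalue M b" "a \<noteq> b" for a b
    using symmetric_eigenvectors_orthogonal[OF assms] f that by blast
  have "independent (f ` {c. eigenvalue M c})"
  proof (rule pairwise_orthogonal_independent)
    show "pairwise orthogonal (f ` {c. eigenvalue M c})"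
      using orth unfolding pairwise_def orthogonal_def by blast
  qed (use f in force)
  then have "finite (f ` {c. eigenvalue M c})" by (rule independent_imp_finite)
  moreover have "inj_on f {c. eigenvalue M c}"
  proof (rule inj_onI)
    fix a b assume *: "a \<in> {c. eigenvalue M c}" "b \<in> {c. eigenvalue M c}" "f a = f b"
    show "a = b"
    proof (rule ccontr)
      assume "a \<noteq> b"
      then have "f a \<bullet> f b = 0" using orth * by blast
      then show False using f[of a] * by simp
    qed
  qed
  ultimately show ?thesis by (rule finite_imageD)
qed

text \<open>
  If the form is positive on the hyperplane \<open>x $ v = 0\<close>, then it cannot be nonpositive on a plane,
  because every plane meets that hyperplane nontrivially.
\<close>

lemma nonpos_eigenvectors_not_orthogonal:
  fixes M :: "real ^ 'n ^ 'n"
  assumes pos: "\<And>w. w \<noteq> 0 \<Longrightarrow> w $ v = 0 \<Longrightarrow> 0 < w \<bullet> (M *v w)"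
    and x: "x \<noteq> 0" "M *v x = a *\<^sub>R x" "a \<le> 0"
    and y: "y \<noteq> 0" "M *v y = b *\<^sub>R y" "b \<le> 0"
  shows "x \<bullet> y \<noteq> 0"
proof
  assume orth: "x \<bullet> y = 0"
  define w where "w = (y $ v) *\<^sub>R x - (x $ v) *\<^sub>R y"
  have yx: "y \<bullet> x = 0" using orth by (simp add: inner_commute)
  have "x $ v \<noteq> 0"
    using pos[of x] x mult_nonpos_nonneg[of a "x \<bullet> x"] by force
  have "w \<bullet> y \<noteq> 0"
    using \<open>x $ v \<noteq> 0\<close> y(1) orth by (simp add: w_def inner_diff_left)
  then have "w \<noteq> 0" by auto
  moreover have "w $ v = 0" by (simp add: w_def)
  ultimately have "0 < w \<bullet> (M *v w)" by (rule pos)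
  also have "w \<bullet> (M *v w) = (y $ v)\<^sup>2 * (a * (x \<bullet> x)) + (x $ v)\<^sup>2 * (b * (y \<bullet> y))"
    using orth yx x(2) y(2)
    by (simp add: w_def power2_eq_square algebra_simps)
  also have "\<dots> \<le> 0"
    using x(3) y(3) by (intro add_nonpos_nonpos mult_nonneg_nonpos mult_nonpos_nonneg) auto
  finally show False by simp
qed

section \<open>Existence of a matrix that attains the parameter\<close>

lemma adjacency_matrix_symmetric: "transpose (adjacency_matrix E) = adjacency_matrix E"
  by (simp add: adjacency_matrix_def transpose_def vec_eq_iff insert_commute)

lemma adjacency_form_le:
  fixes E :: "'v::finite set set"
  shows "w \<bullet> (adjacency_matrix E *v w) \<le> real CARD('v) * (w \<bullet> w)"
proof -
  have "w \<bullet> (adjacency_matrix E *v w)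
      \<le> (\<Sum>i\<in>UNIV. \<Sum>j\<in>UNIV. ((w $ i)\<^sup>2 + (w $ j)\<^sup>2) / 2)"
    unfolding inner_matrix_vector_eq_sum
  proof (intro sum_mono)
    fix i j
    have "2 * (w $ i * w $ j) \<le> (w $ i)\<^sup>2 + (w $ j)\<^sup>2"
      using sum_squares_bound[of "w $ i" "w $ j"] by simp
    then show "adjacency_matrix E $ i $ j * w $ i * w $ j \<le> ((w $ i)\<^sup>2 + (w $ j)\<^sup>2) / 2"
      by (simp add: adjacency_matrix_def)
  qed
  also have "\<dots> = real CARD('v) * (w \<bullet> w)"
    by (simp add: inner_vec_def add_divide_distrib sum.distrib sum_distrib_left
        sum_divide_distrib[symmetric] power2_eq_square)
  finally show ?thesis .
qed

text \<open>Off the diagonal, take the negated adjacency matrix; on it, put -1 at one vertex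
  \<open>v\<close> and a large \<open>t\<close> elsewhere. The form is then negative at the basis
  vector of \<open>v\<close> and positive on the hyperplane \<open>w $ v = 0\<close>, so exactly one
  eigenvalue is nonpositive, it is negative and simple, and the kernel is trivial.\<close>

lemma ex_colin_de_verdiere_matrix:
  fixes E :: "'v::finite set set"
  shows "\<exists>M. colin_de_verdiere_matrix E M"
proof -
  define v where "v = (undefined :: 'v)"
  \<comment> \<open>One more than the bound in \<open>adjacency_form_le\<close>, so that the
    diagonal dominates.\<close>
  define t where "t = real CARD('v) + 1"
  define M :: "real ^ 'v ^ 'v" where
    "M = (\<chi> i j. if i = j then (if i = v then -1 else t) else - adjacency_matrix E $ i $ j)"
  have sym: "transpose M = M"
    by (auto simp: M_def transpose_def vec_eq_iff adjacency_matrix_def insert_commute)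
  have pos: "0 < w \<bullet> (M *v w)" if "w \<noteq> 0" "w $ v = 0" for w
  proof -
    have "t * (w \<bullet> w) - w \<bullet> (adjacency_matrix E *v w)
      = (\<Sum>i\<in>UNIV. \<Sum>j\<in>UNIV. (if i = j then t * w $ i * w $ j else 0)
          - adjacency_matrix E $ i $ j * w $ i * w $ j)"
      unfolding inner_matrix_vector_eq_sum
      by (simp add: sum_subtractf inner_vec_def sum_distrib_left mult.assoc)
    \<comment> \<open>An inequality, because \<open>E\<close> is arbitrary here: a singleton in
      \<open>E\<close> gives the adjacency matrix a diagonal entry 1, which \<open>M\<close> leaves
      out.\<close>
    also have "\<dots> \<le> (\<Sum>i\<in>UNIV. \<Sum>j\<in>UNIV. M $ i $ j * w $ i * w $ j)"
      using that(2) by (intro sum_mono) (auto simp: M_def adjacency_matrix_def)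
    also have "\<dots> = w \<bullet> (M *v w)" by (simp add: inner_matrix_vector_eq_sum)
    finally have "t * (w \<bullet> w) - w \<bullet> (adjacency_matrix E *v w) \<le> w \<bullet> (M *v w)" .
    moreover have "w \<bullet> w > 0" using that(1) by simp
    ultimately show ?thesis
      using adjacency_form_le[of w E] unfolding t_def distrib_right by linarith
  qed
  have "transpose (- M) = - M"
    using sym by (simp add: transpose_def vec_eq_iff)
  then obtain u c' where u: "u \<noteq> 0" "(- M) *v u = c' *\<^sub>R u"
    and max: "\<And>y. y \<bullet> ((- M) *v y) \<le> c' * (y \<bullet> y)"
    using symmetric_matrix_max_eigenvector by blast
  have neg: "(- M) *v y = - (M *v y)" for y
    by (simp add: matrix_vector_mult_def vec_eq_iff sum_negf)
  define c where "c = - c'"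
  have Mu: "M *v u = c *\<^sub>R u" using u(2) by (metis neg c_def minus_equation_iff scaleR_minus_left)
  have "axis v 1 \<bullet> (M *v axis v 1) = -1"
    by (simp add: inner_axis' matrix_vector_mult_basis column_def M_def)
  then have "c < 0"
    using max[of "axis v 1"] by (simp add: neg c_def inner_axis_axis)
  \<comment> \<open>This one fact yields the uniqueness of the negative eigenvalue and its
    multiplicity, and with \<open>a = 0\<close> it shows that the kernel is trivial.\<close>
  have multiple: "x \<in> span {u} \<and> (x = 0 \<or> a = c)"
    if x: "M *v x = a *\<^sub>R x" "a \<le> 0" for x a
  proof (cases "a = c")
    case True
    \<comment> \<open>The component of \<open>x\<close> orthogonal to \<open>u\<close>; if nonzero,
      it would be a second eigenvector with negative eigenvalue, orthogonal to the first.\<close>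
    define y where "y = x - ((x \<bullet> u) / (u \<bullet> u)) *\<^sub>R u"
    have "M *v y = c *\<^sub>R y"
      using x True Mu
      by (simp add: y_def matrix_vector_mult_diff_distrib matrix_vector_mult_scaleR
          scaleR_diff_right mult_ac)
    moreover have "y \<bullet> u = 0" using u(1) by (simp add: y_def inner_diff_left)
    ultimately have "y = 0"
      using nonpos_eigenvectors_not_orthogonal[OF pos, of v y c u c] u(1) Mu \<open>c < 0\<close> by fastforce
    then have "x = ((x \<bullet> u) / (u \<bullet> u)) *\<^sub>R u" by (simp add: y_def)
    then have "x \<in> span {u}" by (metis span_base span_scale singletonI)
    with True show ?thesis by simp
  next
    case False
    then have "x \<bullet> u = 0" using symmetric_eigenvectors_orthogonal[OF sym x(1) Mu] by simp
    then have "x = 0"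
      using nonpos_eigenvectors_not_orthogonal[OF pos, of v x a u c] x u(1) Mu \<open>c < 0\<close> by fastforce
    then show ?thesis by (simp add: span_zero)
  qed
  have "{a. a < 0 \<and> eigenvalue M a} = {c}"
    using multiple \<open>c < 0\<close> Mu u(1) unfolding eigenvalue_def by force
  moreover have "dim (eigenspace M c) = 1"
  proof -
    have "eigenspace M c = span {u}"
    proof
      show "eigenspace M c \<subseteq> span {u}"
        using multiple \<open>c < 0\<close> by (force simp: eigenspace_def)
      show "span {u} \<subseteq> eigenspace M c"
        using Mu
        by (auto simp: eigenspace_def span_singleton matrix_vector_mult_scaleR)
    qed
    then show ?thesis using u(1) by simp
  qed
  moreover have "strong_arnold_property M"
    unfolding strong_arnold_property_def
  proof clarify
    fix X :: "real ^ 'v ^ 'v"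
    assume "M ** X = 0" "X \<noteq> 0"
    have "column j X = 0" for j
    proof -
      have "M *v column j X = 0 *\<^sub>R column j X"
        using \<open>M ** X = 0\<close>
        by (simp add: vec_eq_iff column_def matrix_vector_mult_def matrix_matrix_mult_def)
      with multiple[of "column j X" 0] \<open>c < 0\<close> show ?thesis by simp
    qed
    then have "X = 0" by (simp add: vec_eq_iff column_def)
    with \<open>X \<noteq> 0\<close> show False by simp
  qed
  ultimately have "colin_de_verdiere_matrix E M"
    using sym unfolding colin_de_verdiere_matrix_def
    by (auto simp: M_def adjacency_matrix_def)
  then show ?thesis ..
qed

lemma colin_de_verdiere_attained:
  fixes E :: "'v::finite set set"
  obtains M where "colin_de_verdiere_matrix E M" "colin_de_verdiere E = corank M"
proof -
  let ?K = "{corank M | M. colin_de_verdiere_matrix E M}"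
  have "?K \<subseteq> {..CARD('v)}"
    by (auto simp: corank_def intro: order_trans[OF dim_subset_UNIV])
  then have "finite ?K" by (rule finite_subset) simp
  moreover have "?K \<noteq> {}" using ex_colin_de_verdiere_matrix[of E] by auto
  ultimately have "Max ?K \<in> ?K" by (rule Max_in)
  then show ?thesis using that unfolding colin_de_verdiere_def by blast
qed

section \<open>Dimension counts and the strong Arnold property\<close>

lemma dim_image_inj_on_subspace:
  fixes f :: "'a::euclidean_space \<Rightarrow> 'b::euclidean_space"
  assumes "linear f" "subspace S" "inj_on f S"
  shows "dim (f ` S) = dim S"
proof -
  have "span S = S" using assms(2) by (rule span_eq_iff[THEN iffD2])
  then have "inj_on f (span S)" using assms(3) by (simp only:)
  with assms(1) show ?thesis by (rule dim_image_eq)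
qed

text \<open>For an orthonormal basis of the kernel, of size \<open>k\<close>, the symmetrised
  products of two basis vectors with indices \<open>p \<le> q\<close> are nonzero, pairwise
  orthogonal members of the space, and there are \<open>k * (k + 1) / 2\<close> of them.\<close>

lemma dim_symmetric_matrices_in_kernel:
  fixes M :: "real ^ 'n ^ 'n"
  shows "corank M * (corank M + 1) \<le> 2 * dim {X. transpose X = X \<and> M ** X = 0}"
proof -
  let ?S = "{X :: real ^ 'n ^ 'n. transpose X = X \<and> M ** X = 0}"
  define k where "k = corank M"
  have "subspace {x. M *v x = 0}"
    by (auto simp: subspace_def matrix_vector_right_distrib matrix_vector_mult_scaleR)
  from orthonormal_basis_subspace[OF this] obtain B where B: "B \<subseteq> {x. M *v x = 0}"
    "pairwise orthogonal B" "\<And>x. x \<in> B \<Longrightarrow> norm x = 1" "independent B" "card B = k"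
    unfolding k_def corank_def by metis
  obtain b where b: "bij_betw b {0..<k} B"
    using ex_bij_betw_nat_finite[OF independent_imp_finite[OF B(4)]] B(5) by auto
  have ker: "M *v b p = 0" if "p < k" for p
    using b that B(1) by (force simp: bij_betw_def)
  have on: "b p \<bullet> b q = (if p = q then 1 else 0)" if "p < k" "q < k" for p q
  proof -
    have "b p \<in> B" "b q \<in> B" "p \<noteq> q \<Longrightarrow> b p \<noteq> b q"
      using b that by (auto simp: bij_betw_def inj_on_def)
    then show ?thesis
      using B(2,3) by (auto simp: pairwise_def orthogonal_def dot_square_norm)
  qed
  define I where "I = (SIGMA q:{..<k}. {..q})"
  define F :: "nat \<times> nat \<Rightarrow> real ^ 'n ^ 'n" where
    "F = (\<lambda>(q, p). \<chi> i j. b q $ i * b p $ j + b p $ i * b q $ j)"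
  have inner: "F (q, p) \<bullet> F (q', p')
      = 2 * ((b q \<bullet> b q') * (b p \<bullet> b p') + (b q \<bullet> b p') * (b p \<bullet> b q'))" for q p q' p'
  proof -
    have *: "(\<Sum>i\<in>UNIV. \<Sum>j\<in>UNIV. (x $ i * y $ j) * (z $ i * w $ j)) = (x \<bullet> z) * (y \<bullet> w)"
      for x y z w :: "real ^ 'n"
      unfolding inner_vec_def sum_product by (simp add: mult_ac)
    have "F (q, p) \<bullet> F (q', p') =
        (\<Sum>i\<in>UNIV. \<Sum>j\<in>UNIV. (b q $ i * b p $ j) * (b q' $ i * b p' $ j)
          + (b q $ i * b p $ j) * (b p' $ i * b q' $ j)
          + (b p $ i * b q $ j) * (b q' $ i * b p' $ j)
          + (b p $ i * b q $ j) * (b p' $ i * b q' $ j))"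
      by (simp add: F_def inner_vec_def algebra_simps)
    also have "\<dots> = (b q \<bullet> b q') * (b p \<bullet> b p') + (b q \<bullet> b p') * (b p \<bullet> b q')
        + (b p \<bullet> b q') * (b q \<bullet> b p') + (b p \<bullet> b p') * (b q \<bullet> b q')"
      by (simp only: sum.distrib *)
    finally show ?thesis by simp
  qed
  \<comment> \<open>The second product in \<open>inner\<close> is nonzero only for
    \<open>q = p'\<close> and \<open>p = q'\<close>; with \<open>p \<le> q\<close> and
    \<open>p' \<le> q'\<close> this makes the two pairs equal.\<close>
  have orth: "F s \<bullet> F t = 0" if "s \<in> I" "t \<in> I" "s \<noteq> t" for s t
    using that by (cases s; cases t) (auto simp: I_def inner on)
  have self: "F s \<bullet> F s \<noteq> 0" if "s \<in> I" for s
    using that by (cases s) (auto simp: I_def inner on)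
  have "inj_on F I"
    by (rule inj_onI) (metis orth self)
  have ind: "independent (F ` I)"
  proof (rule pairwise_orthogonal_independent)
    show "pairwise orthogonal (F ` I)"
      using orth unfolding pairwise_def orthogonal_def by blast
    show "0 \<notin> F ` I" using self by force
  qed
  have "F ` I \<subseteq> ?S"
  proof safe
    fix q p assume "(q, p) \<in> I"
    then have *: "q < k" "p < k" by (auto simp: I_def)
    show "transpose (F (q, p)) = F (q, p)"
      by (simp add: F_def transpose_def vec_eq_iff mult_ac)
    have "(M ** F (q, p)) $ i $ j = (M *v b q) $ i * b p $ j + (M *v b p) $ i * b q $ j" for i j
      by (simp add: F_def matrix_matrix_mult_def matrix_vector_mult_def sum.distrib
          sum_distrib_left sum_distrib_right distrib_left mult_ac)
    then show "M ** F (q, p) = 0" using ker * by (simp add: vec_eq_iff)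
  qed
  then have "card (F ` I) \<le> dim ?S" using ind by (rule independent_card_le_dim)
  moreover have "2 * card (F ` I) = k * (k + 1)"
  proof -
    have "card (F ` I) = (\<Sum>q<k. Suc q)"
      using card_image[OF \<open>inj_on F I\<close>] by (simp add: I_def)
    moreover have "2 * (\<Sum>q<k. Suc q) = k * (k + 1)" by (induction k) auto
    ultimately show ?thesis by simp
  qed
  ultimately show ?thesis unfolding k_def by linarith
qed

text \<open>One symmetric 0-1 matrix for each vertex and each edge suffices to span the
  space.\<close>

lemma dim_graph_matrices_le:
  fixes E :: "'v::finite set set"
  shows "dim {X :: real ^ 'v ^ 'v. transpose X = X \<and> (\<forall>i j. i \<noteq> j \<longrightarrow> {i, j} \<notin> E \<longrightarrow> X $ i $ j = 0)}
    \<le> CARD('v) + card E" (is "dim ?W \<le> _")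
proof -
  define T where "T = E \<union> range (\<lambda>i. {i})"
  define G :: "'v set \<Rightarrow> real ^ 'v ^ 'v" where "G s = (\<chi> i j. if {i, j} = s then 1 else 0)" for s
  have "?W \<subseteq> span (G ` T)"
  proof
    fix X assume X: "X \<in> ?W"
    \<comment> \<open>The entry of \<open>X\<close> as a function of an unordered pair, well defined
      because \<open>X\<close> is symmetric.\<close>
    define f where "f s = (SOME r. \<exists>i j. s = {i, j} \<and> r = X $ i $ j)" for s
    have f: "f {i, j} = X $ i $ j" for i j
    proof -
      have "X $ i $ j = X $ j $ i"
        using X by (auto simp: transpose_def vec_eq_iff)
      then show ?thesis
        unfolding f_def by (intro some_equality) (auto simp: doubleton_eq_iff)
    qed
    have "X = (\<Sum>s\<in>T. f s *\<^sub>R G s)"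
    proof -
      have "(\<Sum>s\<in>T. f s *\<^sub>R G s) $ i $ j = X $ i $ j" for i j
      proof -
        have "(\<Sum>s\<in>T. f s *\<^sub>R G s) $ i $ j = (\<Sum>s\<in>T. if {i, j} = s then f s else 0)"
          by (simp add: G_def if_distrib cong: if_cong)
        also have "\<dots> = (if {i, j} \<in> T then X $ i $ j else 0)"
          by (simp add: f)
        also have "\<dots> = X $ i $ j"
          using X by (auto simp: T_def)
        finally show ?thesis .
      qed
      then show ?thesis by (simp add: vec_eq_iff)
    qed
    then show "X \<in> span (G ` T)"
      by (metis (no_types, lifting) imageI span_base span_scale span_sum)
  qed
  then have "dim ?W \<le> card (G ` T)" by (rule dim_le_card) simp
  also have "\<dots> \<le> card T" by (rule card_image_le) simp
  also have "\<dots> \<le> card E + card (range (\<lambda>i::'v. {i}))"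
    unfolding T_def by (rule card_Un_le)
  also have "card (range (\<lambda>i::'v. {i})) = CARD('v)" by (rule card_image) simp
  finally show ?thesis by simp
qed

text \<open>Two mutually orthogonal subspaces are fitted into the space of dimension at most
  \<open>CARD('v) + card E\<close>. One is the image of the symmetric \<open>X\<close> with
  \<open>M ** X = 0\<close> under restriction to the diagonal and the support of \<open>M\<close>,
  injective by the strong Arnold property. The other consists of the matrices \<open>L d\<close>,
  that is, \<open>M\<close> multiplied by the diagonal matrix of \<open>d\<close> on the left plus
  the same on the right; the assumption \<open>inj\<close> is injectivity of this map on
  \<open>D\<close>.\<close>

lemma corank_dimension_count:
  fixes E :: "'v::finite set set"
  assumes M: "colin_de_verdiere_matrix E M" and "subspace D"
    and inj: "\<And>d. d \<in> D \<Longrightarrow> (\<And>i j. (d $ i + d $ j) * M $ i $ j = 0) \<Longrightarrow> d = 0"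
  shows "corank M * (corank M + 1) + 2 * dim D \<le> 2 * (CARD('v) + card E)"
proof -
  let ?S = "{X. transpose X = X \<and> M ** X = 0}"
  let ?W = "{X :: real ^ 'v ^ 'v. transpose X = X \<and> (\<forall>i j. i \<noteq> j \<longrightarrow> {i, j} \<notin> E \<longrightarrow> X $ i $ j = 0)}"
  define P :: "real ^ 'v ^ 'v \<Rightarrow> real ^ 'v ^ 'v" where
    "P X = (\<chi> i j. if i = j \<or> M $ i $ j \<noteq> 0 then X $ i $ j else 0)" for X
  define L :: "real ^ 'v \<Rightarrow> real ^ 'v ^ 'v" where
    "L d = (\<chi> i j. (d $ i + d $ j) * M $ i $ j)" for d
  have symD: "X $ i $ j = X $ j $ i" if "transpose X = X" for X :: "real ^ 'v ^ 'v" and i j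
    using that by (auto simp: transpose_def vec_eq_iff)
  have symM: "M $ i $ j = M $ j $ i" for i j
    by (rule symD) (use M in \<open>simp add: colin_de_verdiere_matrix_def\<close>)
  have zeroM: "M $ i $ j = 0" if "i \<noteq> j" "{i, j} \<notin> E" for i j
    using M that by (simp add: colin_de_verdiere_matrix_def)
  have sap: "strong_arnold_property M"
    using M by (simp add: colin_de_verdiere_matrix_def)
  have "subspace ?S"
  proof -
    have "M ** (c *\<^sub>R X) = c *\<^sub>R (M ** X)" for c and X :: "real ^ 'v ^ 'v"
      by (simp add: vec_eq_iff matrix_matrix_mult_def sum_distrib_left mult.left_commute)
    then show ?thesis
      by (auto simp: subspace_def matrix_add_ldistrib transpose_def vec_eq_iff)
  qed
  have "linear P"
    by (rule linearI) (simp_all add: P_def vec_eq_iff)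
  have "linear L"
    by (rule linearI) (simp_all add: L_def vec_eq_iff algebra_simps)
  have "inj_on P ?S"
    unfolding linear_injective_on_subspace_0[OF \<open>linear P\<close> \<open>subspace ?S\<close>]
  proof safe
    fix X assume X: "transpose X = X" "M ** X = 0" "P X = 0"
    have "X $ i $ j = 0" if "i = j \<or> M $ i $ j \<noteq> 0" for i j
    proof -
      have "X $ i $ j = P X $ i $ j" using that by (auto simp: P_def)
      then show ?thesis using X(3) by simp
    qed
    then show "X = 0"
      using sap X(1,2) unfolding strong_arnold_property_def by blast
  qed
  then have dimP: "dim (P ` ?S) = dim ?S"
    by (rule dim_image_inj_on_subspace[OF \<open>linear P\<close> \<open>subspace ?S\<close>])
  have "inj_on L D"
    unfolding linear_injective_on_subspace_0[OF \<open>linear L\<close> \<open>subspace D\<close>]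
  proof safe
    fix d assume d: "d \<in> D" "L d = 0"
    have "(d $ i + d $ j) * M $ i $ j = L d $ i $ j" for i j by (simp add: L_def)
    then show "d = 0" by (intro inj d(1)) (simp add: d(2))
  qed
  then have dimL: "dim (L ` D) = dim D"
    by (rule dim_image_inj_on_subspace[OF \<open>linear L\<close> \<open>subspace D\<close>])
  have orth: "P X \<bullet> L d = 0" if X: "X \<in> ?S" for X d
  proof -
    have symX: "X $ i $ j = X $ j $ i" for i j using X by (intro symD) simp
    \<comment> \<open>By symmetry of \<open>X\<close> this row sum is a diagonal entry of
      \<open>M ** X\<close>.\<close>
    have tr: "(\<Sum>j\<in>UNIV. M $ i $ j * X $ i $ j) = 0" for i
    proof -
      have "(M ** X) $ i $ i = 0" using X by simp
      moreover have "(M ** X) $ i $ i = (\<Sum>j\<in>UNIV. M $ i $ j * X $ i $ j)"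
        unfolding matrix_matrix_mult_def by (simp, intro sum.cong refl, metis symX)
      ultimately show ?thesis by simp
    qed
    \<comment> \<open>Wherever \<open>P\<close> erases an entry of \<open>X\<close>, the entry of
      \<open>M\<close> is zero, and so is that of \<open>L d\<close>.\<close>
    have "P X \<bullet> L d = (\<Sum>i\<in>UNIV. \<Sum>j\<in>UNIV. X $ i $ j * ((d $ i + d $ j) * M $ i $ j))"
      by (auto simp: inner_vec_def P_def L_def intro!: sum.cong)
    also have "\<dots> = (\<Sum>i\<in>UNIV. \<Sum>j\<in>UNIV. d $ i * (M $ i $ j * X $ i $ j))
        + (\<Sum>i\<in>UNIV. \<Sum>j\<in>UNIV. d $ j * (M $ i $ j * X $ i $ j))"
      by (simp add: sum.distrib[symmetric] algebra_simps)
    also have "(\<Sum>i\<in>UNIV. \<Sum>j\<in>UNIV. d $ j * (M $ i $ j * X $ i $ j))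
        = (\<Sum>j\<in>UNIV. \<Sum>i\<in>UNIV. d $ j * (M $ j $ i * X $ j $ i))"
      by (subst sum.swap, intro sum.cong refl, metis symX symM)
    finally show ?thesis by (simp add: sum_distrib_left[symmetric] tr)
  qed
  have "P ` ?S \<union> L ` D \<subseteq> ?W"
    using symD symM zeroM by (auto simp: P_def L_def transpose_def vec_eq_iff)
  then have "dim (P ` ?S \<union> L ` D) \<le> dim ?W" by (rule dim_subset)
  moreover have "dim (P ` ?S \<union> L ` D) = dim (P ` ?S) + dim (L ` D)"
    using orth by (intro dim_orthogonal_sum) blast
  ultimately have *: "dim ?S + dim D \<le> CARD('v) + card E"
    using dimP dimL dim_graph_matrices_le[of E] by linarith
  have "corank M * (corank M + 1) + 2 * dim D \<le> 2 * dim ?S + 2 * dim D"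
    by (intro add_right_mono dim_symmetric_matrices_in_kernel)
  also have "\<dots> \<le> 2 * (CARD('v) + card E)" using * by simp
  finally show ?thesis .
qed

section \<open>Bounds on adjacency eigenvalues\<close>

lemma adjacency_diag_zero:
  assumes "simple_graph E"
  shows "adjacency_matrix E $ i $ i = 0"
  using assms by (force simp: simple_graph_def adjacency_matrix_def)

lemma sum_adjacency_matrix:
  fixes E :: "'v::finite set set"
  assumes "simple_graph E"
  shows "(\<Sum>i\<in>UNIV. \<Sum>j\<in>UNIV. adjacency_matrix E $ i $ j) = 2 * real (card E)"
proof -
  have pair: "(\<Sum>i\<in>UNIV. \<Sum>j\<in>UNIV. if {i, j} = e then 1 else 0) = (2::real)" if "e \<in> E" for e
  proof -
    have "card e = 2" using assms that by (simp add: simple_graph_def)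
    then obtain a b where e: "e = {a, b}" "a \<noteq> b" by (auto simp: card_2_iff)
    have "(if {i, j} = e then 1 else 0 :: real)
        = (if i = a then if j = b then 1 else 0 else 0) + (if i = b then if j = a then 1 else 0 else 0)"
      for i j using e by (auto simp: doubleton_eq_iff)
    then have "(\<Sum>i\<in>UNIV. \<Sum>j\<in>UNIV. if {i, j} = e then 1 else 0 :: real)
        = (\<Sum>i\<in>UNIV. if i = a then \<Sum>j\<in>UNIV. if j = b then 1 else 0 else 0)
        + (\<Sum>i\<in>UNIV. if i = b then \<Sum>j\<in>UNIV. if j = a then 1 else 0 else 0)"
      by (simp only: sum.distrib) (intro arg_cong2[where f = "(+)"] sum.cong; simp)
    then show ?thesis by simp
  qed
  have "(\<Sum>i\<in>UNIV. \<Sum>j\<in>UNIV. adjacency_matrix E $ i $ j)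
      = (\<Sum>i\<in>UNIV. \<Sum>j\<in>UNIV. \<Sum>e\<in>E. if {i, j} = e then 1 else 0)"
    by (simp add: adjacency_matrix_def)
  also have "\<dots> = (\<Sum>i\<in>UNIV. \<Sum>e\<in>E. \<Sum>j\<in>UNIV. if {i, j} = e then 1 else 0)"
    by (intro sum.cong sum.swap refl)
  also have "\<dots> = (\<Sum>e\<in>E. \<Sum>i\<in>UNIV. \<Sum>j\<in>UNIV. if {i, j} = e then 1 else 0)"
    by (rule sum.swap)
  also have "\<dots> = 2 * real (card E)" by (simp add: pair)
  finally show ?thesis .
qed

text \<open>Cauchy-Schwarz on row \<open>i\<close> of the eigenvalue equation; the entries are 0 or
  1, hence equal to their squares, and the first factor is the degree of \<open>i\<close>.\<close>

lemma adjacency_eigenvector_row_bound: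
  fixes E :: "'v::finite set set"
  assumes "adjacency_matrix E *v x = c *\<^sub>R x"
  shows "c\<^sup>2 * (x $ i)\<^sup>2 \<le>
    (\<Sum>j\<in>UNIV. adjacency_matrix E $ i $ j) * (\<Sum>j\<in>UNIV. adjacency_matrix E $ i $ j * (x $ j)\<^sup>2)"
proof -
  let ?A = "adjacency_matrix E"
  have idem: "?A $ i $ j * ?A $ i $ j = ?A $ i $ j" for j by (simp add: adjacency_matrix_def)
  have "c * x $ i = (?A *v x) $ i" by (simp add: assms)
  also have "\<dots> = (\<Sum>j\<in>UNIV. ?A $ i $ j * (?A $ i $ j * x $ j))"
    by (simp add: matrix_vector_mult_def mult.assoc[symmetric] idem)
  finally have "c\<^sup>2 * (x $ i)\<^sup>2 = (\<Sum>j\<in>UNIV. ?A $ i $ j * (?A $ i $ j * x $ j))\<^sup>2"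
    by (metis power_mult_distrib)
  also have "\<dots> \<le> (\<Sum>j\<in>UNIV. (?A $ i $ j)\<^sup>2) * (\<Sum>j\<in>UNIV. (?A $ i $ j * x $ j)\<^sup>2)"
    by (rule Cauchy_Schwarz_ineq_sum)
  finally show ?thesis by (simp add: power_mult_distrib idem power2_eq_square[of "?A $ i $ j" for j])
qed

text \<open>Stanley's bound. In the row bound, the sum over the neighbours of \<open>i\<close> is at
  most \<open>x \<bullet> x - (x $ i)\<^sup>2\<close>. Summing over \<open>i\<close> leaves a
  negative term, the degree-weighted sum of squares, which is at least
  \<open>c * (x \<bullet> x)\<close> in absolute value and supplies the linear term in
  \<open>c\<close>.\<close>

lemma adjacency_eigenvalue_bound:
  fixes E :: "'v::finite set set"
  assumes "simple_graph E" "eigenvalue (adjacency_matrix E) c"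
  shows "c * (c + 1) \<le> 2 * real (card E)"
proof -
  let ?A = "adjacency_matrix E"
  obtain x where x: "x \<noteq> 0" "?A *v x = c *\<^sub>R x"
    using assms(2) unfolding eigenvalue_def by blast
  have xx: "x \<bullet> x = (\<Sum>j\<in>UNIV. (x $ j)\<^sup>2)" by (simp add: inner_vec_def power2_eq_square)
  have A0: "?A $ i $ j \<ge> 0" for i j by (simp add: adjacency_matrix_def)
  have nbr: "(\<Sum>j\<in>UNIV. ?A $ i $ j * (x $ j)\<^sup>2) \<le> x \<bullet> x - (x $ i)\<^sup>2" for i
  proof -
    have "(\<Sum>j\<in>UNIV. ?A $ i $ j * (x $ j)\<^sup>2)
        \<le> (\<Sum>j\<in>UNIV. (x $ j)\<^sup>2 - (if j = i then (x $ j)\<^sup>2 else 0))"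
      using adjacency_diag_zero[OF assms(1)]
      by (intro sum_mono) (auto simp: adjacency_matrix_def)
    then show ?thesis by (simp add: sum_subtractf xx)
  qed
  have "c * (x \<bullet> x) = (\<Sum>i\<in>UNIV. \<Sum>j\<in>UNIV. ?A $ i $ j * x $ i * x $ j)"
    using inner_matrix_vector_eq_sum[of x ?A] by (simp add: x(2))
  \<comment> \<open>The second summand is the first with \<open>i\<close> and \<open>j\<close>
    exchanged, so both double sums agree after swapping the order of summation.\<close>
  also have "\<dots> \<le> (\<Sum>i\<in>UNIV. \<Sum>j\<in>UNIV. (?A $ i $ j * (x $ i)\<^sup>2 + ?A $ j $ i * (x $ j)\<^sup>2) / 2)"
  proof (intro sum_mono)
    fix i j
    have "2 * (x $ i * x $ j) \<le> (x $ i)\<^sup>2 + (x $ j)\<^sup>2"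
      using sum_squares_bound[of "x $ i" "x $ j"] by simp
    then show "?A $ i $ j * x $ i * x $ j \<le> (?A $ i $ j * (x $ i)\<^sup>2 + ?A $ j $ i * (x $ j)\<^sup>2) / 2"
      by (simp add: adjacency_matrix_def insert_commute)
  qed
  also have "\<dots> = ((\<Sum>i\<in>UNIV. \<Sum>j\<in>UNIV. ?A $ i $ j * (x $ i)\<^sup>2)
      + (\<Sum>i\<in>UNIV. \<Sum>j\<in>UNIV. ?A $ j $ i * (x $ j)\<^sup>2)) / 2"
    by (simp only: sum_divide_distrib[symmetric] sum.distrib)
  also have "(\<Sum>i\<in>UNIV. \<Sum>j\<in>UNIV. ?A $ j $ i * (x $ j)\<^sup>2)
      = (\<Sum>i\<in>UNIV. \<Sum>j\<in>UNIV. ?A $ i $ j * (x $ i)\<^sup>2)" by (rule sum.swap)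
  finally have deg: "c * (x \<bullet> x) \<le> (\<Sum>i\<in>UNIV. (\<Sum>j\<in>UNIV. ?A $ i $ j) * (x $ i)\<^sup>2)"
    by (simp add: sum_distrib_right)
  have "c\<^sup>2 * (x \<bullet> x) = (\<Sum>i\<in>UNIV. c\<^sup>2 * (x $ i)\<^sup>2)"
    by (simp add: xx sum_distrib_left)
  also have "\<dots> \<le> (\<Sum>i\<in>UNIV. (\<Sum>j\<in>UNIV. ?A $ i $ j) * (x \<bullet> x - (x $ i)\<^sup>2))"
  proof (intro sum_mono order_trans[OF adjacency_eigenvector_row_bound[OF x(2)]])
    fix i
    show "(\<Sum>j\<in>UNIV. ?A $ i $ j) * (\<Sum>j\<in>UNIV. ?A $ i $ j * (x $ j)\<^sup>2)
        \<le> (\<Sum>j\<in>UNIV. ?A $ i $ j) * (x \<bullet> x - (x $ i)\<^sup>2)"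
      by (intro mult_left_mono nbr sum_nonneg A0)
  qed
  also have "\<dots> = 2 * real (card E) * (x \<bullet> x) - (\<Sum>i\<in>UNIV. (\<Sum>j\<in>UNIV. ?A $ i $ j) * (x $ i)\<^sup>2)"
    by (simp add: right_diff_distrib sum_subtractf sum_distrib_right[symmetric]
        sum_adjacency_matrix[OF assms(1)])
  finally have "(c * (c + 1)) * (x \<bullet> x) \<le> 2 * real (card E) * (x \<bullet> x)"
    using deg by (simp add: power2_eq_square algebra_simps)
  then show ?thesis using x(1) by (simp add: mult_le_cancel_right)
qed

text \<open>Neighbours of a vertex on one side all lie on the other, and the degrees on one side add
  up to the number of edges. Summing the row bound over each side and adding the two results gives
  the claim.\<close>

lemma bipartite_eigenvalue_square_le:
  fixes E :: "'v::finite set set"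
  assumes "simple_graph E" "eigenvalue (adjacency_matrix E) c"
    and bip: "\<And>i j. {i, j} \<in> E \<Longrightarrow> i \<in> P \<longleftrightarrow> j \<notin> P"
  shows "c\<^sup>2 \<le> real (card E)"
proof -
  let ?A = "adjacency_matrix E"
  obtain x where x: "x \<noteq> 0" "?A *v x = c *\<^sub>R x"
    using assms(2) unfolding eigenvalue_def by blast
  have A0: "?A $ i $ j \<ge> 0" for i j by (simp add: adjacency_matrix_def)
  have symA: "?A $ i $ j = ?A $ j $ i" for i j by (simp add: adjacency_matrix_def insert_commute)
  have split: "sum f UNIV = sum f Q + sum f (- Q)" for f :: "'v \<Rightarrow> real" and Q
    by (metis finite_code sum.subset_diff Compl_eq_Diff_UNIV subset_UNIV add.commute)
  have cross: "(\<Sum>j\<in>UNIV. ?A $ i $ j * f j) = (\<Sum>j\<in>-Q. ?A $ i $ j * f j)"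
    if "i \<in> Q" "Q = P \<or> Q = - P" for i Q f
    using that bip by (intro sum.mono_neutral_right) (auto simp: adjacency_matrix_def)
  \<comment> \<open>Counting edges from \<open>Q\<close> and from its complement gives the same
    number, and the two counts add up to \<open>2 * card E\<close>.\<close>
  have edges: "(\<Sum>i\<in>Q. \<Sum>j\<in>UNIV. ?A $ i $ j) = real (card E)" if Q: "Q = P \<or> Q = - P" for Q
  proof -
    have Q': "- Q = P \<or> - Q = - P" using Q by auto
    have "(\<Sum>i\<in>Q. \<Sum>j\<in>UNIV. ?A $ i $ j) = (\<Sum>i\<in>Q. \<Sum>j\<in>-Q. ?A $ i $ j)"
      using cross[OF _ Q, of _ "\<lambda>_. 1"] by simp
    also have "\<dots> = (\<Sum>j\<in>-Q. \<Sum>i\<in>Q. ?A $ j $ i)"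
      by (subst sum.swap) (simp add: symA)
    also have "\<dots> = (\<Sum>i\<in>-Q. \<Sum>j\<in>UNIV. ?A $ i $ j)"
      using cross[OF _ Q', of _ "\<lambda>_. 1"] by simp
    finally show ?thesis
      using sum_adjacency_matrix[OF assms(1)] split[of "\<lambda>i. \<Sum>j\<in>UNIV. ?A $ i $ j" Q] by simp
  qed
  have side: "c\<^sup>2 * (\<Sum>i\<in>Q. (x $ i)\<^sup>2) \<le> real (card E) * (\<Sum>i\<in>-Q. (x $ i)\<^sup>2)"
    if Q: "Q = P \<or> Q = - P" for Q
  proof -
    have "c\<^sup>2 * (\<Sum>i\<in>Q. (x $ i)\<^sup>2) = (\<Sum>i\<in>Q. c\<^sup>2 * (x $ i)\<^sup>2)"
      by (simp add: sum_distrib_left)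
    also have "\<dots> \<le> (\<Sum>i\<in>Q. (\<Sum>j\<in>UNIV. ?A $ i $ j) * (\<Sum>i\<in>-Q. (x $ i)\<^sup>2))"
    proof (intro sum_mono order_trans[OF adjacency_eigenvector_row_bound[OF x(2)]])
      fix i assume "i \<in> Q"
      have "(\<Sum>j\<in>UNIV. ?A $ i $ j * (x $ j)\<^sup>2) = (\<Sum>j\<in>-Q. ?A $ i $ j * (x $ j)\<^sup>2)"
        using \<open>i \<in> Q\<close> Q by (rule cross)
      also have "\<dots> \<le> (\<Sum>j\<in>-Q. (x $ j)\<^sup>2)"
        by (intro sum_mono) (simp add: adjacency_matrix_def)
      finally show "(\<Sum>j\<in>UNIV. ?A $ i $ j) * (\<Sum>j\<in>UNIV. ?A $ i $ j * (x $ j)\<^sup>2)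
          \<le> (\<Sum>j\<in>UNIV. ?A $ i $ j) * (\<Sum>i\<in>-Q. (x $ i)\<^sup>2)"
        by (intro mult_left_mono sum_nonneg A0)
    qed
    also have "\<dots> = real (card E) * (\<Sum>i\<in>-Q. (x $ i)\<^sup>2)"
      by (simp add: sum_distrib_right[symmetric] edges[OF Q])
    finally show ?thesis .
  qed
  have "x \<bullet> x = (\<Sum>i\<in>P. (x $ i)\<^sup>2) + (\<Sum>i\<in>-P. (x $ i)\<^sup>2)"
    using split[of "\<lambda>i. (x $ i)\<^sup>2" P] by (simp add: inner_vec_def power2_eq_square)
  then have "c\<^sup>2 * (x \<bullet> x) \<le> real (card E) * (x \<bullet> x)"
    using side[of P] side[of "- P"] by (simp add: distrib_left)
  then show ?thesis using x(1) by (simp add: mult_le_cancel_right)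
qed

text \<open>Testing the form at the all-ones vector shows that some eigenvalue is at least the
  average degree.\<close>

lemma largest_adjacency_eigenvalue_pos:
  fixes E :: "'v::finite set set"
  assumes "simple_graph E" "card E \<ge> 1"
  shows "eigenvalue (adjacency_matrix E) (largest_adjacency_eigenvalue E)"
    and "largest_adjacency_eigenvalue E > 0"
proof -
  let ?A = "adjacency_matrix E"
  obtain x c where x: "x \<noteq> 0" "?A *v x = c *\<^sub>R x"
    and max: "\<And>y. y \<bullet> (?A *v y) \<le> c * (y \<bullet> y)"
    using symmetric_matrix_max_eigenvector[OF adjacency_matrix_symmetric] by blast
  have c: "eigenvalue ?A c" using x unfolding eigenvalue_def by blast
  have "2 * real (card E) = (\<chi> i. 1) \<bullet> (?A *v (\<chi> i. 1))"
    unfolding inner_matrix_vector_eq_sum using sum_adjacency_matrix[OF assms(1)] by simp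
  also have "\<dots> \<le> c * real CARD('v)"
    using max[of "\<chi> i. 1"] by (simp add: inner_vec_def[of "\<chi> i. 1" "\<chi> i. 1"])
  finally have "2 * real (card E) \<le> c * real CARD('v)" .
  then have "c * real CARD('v) > 0" using assms(2) by linarith
  then have "c > 0" by (simp add: zero_less_mult_iff)
  have fin: "finite {c. eigenvalue ?A c}"
    by (rule finite_eigenvalues[OF adjacency_matrix_symmetric])
  show "eigenvalue ?A (largest_adjacency_eigenvalue E)"
    using Max_in[OF fin] c unfolding largest_adjacency_eigenvalue_def by blast
  have "c \<le> largest_adjacency_eigenvalue E"
    unfolding largest_adjacency_eigenvalue_def using fin c by (intro Max_ge) auto
  with \<open>c > 0\<close> show "largest_adjacency_eigenvalue E > 0" by linarith
qed

section \<open>Connectivity and the path on three vertices\<close>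

lemma connected_graph_induct:
  assumes "connected_graph E" "P u" "\<And>i j. {i, j} \<in> E \<Longrightarrow> P i \<Longrightarrow> P j"
  shows "P v"
proof -
  have "(u, v) \<in> {(a, b). {a, b} \<in> E}\<^sup>*"
    using assms(1) by (auto simp: connected_graph_def)
  then show ?thesis by (induction) (use assms(2,3) in auto)
qed

lemma path_graph_3_structure:
  assumes "simple_graph E" "connected_graph E" "card E = 2"
  obtains a b c where "a \<noteq> b" "b \<noteq> c" "a \<noteq> c" "E = {{a, b}, {b, c}}" "UNIV = {a, b, c}"
proof -
  obtain e f where ef: "E = {e, f}" "e \<noteq> f"
    using assms(3) by (auto simp: card_2_iff)
  have card: "card e = 2" "card f = 2" using assms(1) ef by (auto simp: simple_graph_def)
  have "\<not> f \<subseteq> e" using ef(2) card by (metis card_subset_eq card.infinite zero_neq_numeral)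
  then obtain c where c: "c \<in> f" "c \<notin> e" by blast
  obtain u where u: "u \<in> e" using card by fastforce
  \<comment> \<open>Connectivity forces an edge to leave \<open>e\<close>; it can only be
    \<open>f\<close>, so the two edges share a vertex.\<close>
  have "\<exists>i j. {i, j} \<in> E \<and> i \<in> e \<and> j \<notin> e"
    using connected_graph_induct[OF assms(2), of "\<lambda>v. v \<in> e" u c] u c by blast
  then obtain b c' where bc: "f = {b, c'}" "b \<in> e" "c' \<notin> e" using ef by auto
  then obtain a where a: "e = {a, b}" "a \<noteq> b" using card by (auto simp: card_2_iff)
  have "v \<in> {a, b, c'}" for v
  proof (rule connected_graph_induct[OF assms(2), where P = "\<lambda>v. v \<in> {a, b, c'}" and u = a])
    show "a \<in> {a, b, c'}" by simp
    show "j \<in> {a, b, c'}" if "{i, j} \<in> E" for i j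
      using that ef a bc by auto
  qed
  then show ?thesis using that[of a b c'] ef a bc by auto
qed

text \<open>A kernel vector is determined by its entry at the end \<open>a\<close>: if that is zero,
  row \<open>a\<close> forces the entry at \<open>b\<close> to vanish, and row \<open>b\<close> the
  entry at \<open>c\<close>.\<close>

lemma path_graph_3_corank_le:
  fixes E :: "'v::finite set set"
  assumes "simple_graph E" "connected_graph E" "card E = 2"
    and M: "colin_de_verdiere_matrix E M" and diag: "\<And>i. M $ i $ i = 0"
  shows "corank M \<le> 1"
proof -
  obtain a b c where abc: "a \<noteq> b" "b \<noteq> c" "a \<noteq> c" "E = {{a, b}, {b, c}}" "UNIV = {a, b, c}"
    using path_graph_3_structure[OF assms(1-3)] by blast
  have M0: "M $ a $ c = 0" "M $ a $ b \<noteq> 0" "M $ b $ c \<noteq> 0"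
  proof -
    have off: "i \<noteq> j \<Longrightarrow> M $ i $ j \<noteq> 0 \<longleftrightarrow> {i, j} \<in> E" for i j
      using M unfolding colin_de_verdiere_matrix_def by (metis less_irrefl)
    have "{a, c} \<notin> E" "{a, b} \<in> E" "{b, c} \<in> E"
      using abc(1-4) by (auto simp: doubleton_eq_iff)
    then show "M $ a $ c = 0" "M $ a $ b \<noteq> 0" "M $ b $ c \<noteq> 0"
      using off abc(1-3) by blast+
  qed
  let ?K = "{x. M *v x = 0}"
  let ?f = "\<lambda>x :: real ^ 'v. x $ a"
  have sub: "subspace ?K"
    by (auto simp: subspace_def matrix_vector_right_distrib matrix_vector_mult_scaleR)
  have lin: "linear ?f" by (rule linearI) simp_all
  have "inj_on ?f ?K"
    unfolding linear_injective_on_subspace_0[OF lin sub]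
  proof safe
    fix x assume x: "M *v x = 0" "x $ a = 0"
    have row: "M $ i $ a * x $ a + M $ i $ b * x $ b + M $ i $ c * x $ c = 0" for i
    proof -
      have "(M *v x) $ i = 0" using x(1) by simp
      then show ?thesis using abc(1-3) by (simp add: matrix_vector_mult_def abc(5))
    qed
    have "x $ b = 0" using row[of a] M0 x(2) by simp
    moreover have "x $ c = 0" using row[of b] M0 x(2) diag[of b] by simp
    ultimately have "x $ i = 0" for i using x(2) abc(5) UNIV_I[of i] by auto
    then show "x = 0" by (simp add: vec_eq_iff)
  qed
  then have "dim (?f ` ?K) = corank M"
    unfolding corank_def by (rule dim_image_inj_on_subspace[OF lin sub])
  moreover have "dim (?f ` ?K) \<le> DIM(real)" by (rule dim_subset_UNIV)
  ultimately show ?thesis by simp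
qed

section \<open>Corank against the number of edges\<close>

text \<open>This describes the kernel of the map from \<open>d\<close> to the matrix with entries
  \<open>(d $ i + d $ j) * M $ i $ j\<close>: since \<open>M\<close> is nonzero on edges,
  \<open>d\<close> changes sign along each edge, and connectivity spreads its absolute value over
  the graph.\<close>

lemma skew_diagonal_abs_const:
  fixes E :: "'v::finite set set"
  assumes "connected_graph E" "simple_graph E" and M: "colin_de_verdiere_matrix E M"
    and d: "\<And>i j. (d $ i + d $ j) * M $ i $ j = 0"
  shows "{i, j} \<in> E \<Longrightarrow> d $ j = - d $ i" and "\<bar>d $ u\<bar> = \<bar>d $ v\<bar>"
proof -
  show edge: "d $ j = - d $ i" if "{i, j} \<in> E" for i j
  proof -
    have "i \<noteq> j" using that assms(2) by (force simp: simple_graph_def)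
    then have "M $ i $ j < 0" using M that by (simp add: colin_de_verdiere_matrix_def)
    then show ?thesis using d[of i j] by simp
  qed
  show "\<bar>d $ u\<bar> = \<bar>d $ v\<bar>"
    by (rule connected_graph_induct[OF assms(1), of "\<lambda>v. \<bar>d $ u\<bar> = \<bar>d $ v\<bar>"])
      (auto dest: edge)
qed

text \<open>
  The weaker bound of the second case is attained by \<open>K\<^sub>3\<^sub>,\<^sub>3\<close>, where \<open>k = 4\<close> and \<open>m = 9\<close>.
\<close>

lemma corank_bound_cases:
  fixes E :: "'v::finite set set"
  assumes "simple_graph E" "connected_graph E" and M: "colin_de_verdiere_matrix E M"
  obtains "corank M * (corank M + 1) \<le> 2 * card E"
  | P where "\<And>i j. {i, j} \<in> E \<Longrightarrow> i \<in> P \<longleftrightarrow> j \<notin> P" "\<And>i. M $ i $ i = 0"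
      "corank M * (corank M + 1) \<le> 2 * card E + 2"
proof (cases "\<exists>d. d \<noteq> 0 \<and> (\<forall>i j. (d $ i + d $ j) * M $ i $ j = 0)")
  case False
  then have "corank M * (corank M + 1) + 2 * dim (UNIV :: (real ^ 'v) set) \<le> 2 * (CARD('v) + card E)"
    by (intro corank_dimension_count[OF M]) auto
  then show ?thesis using that(1) by simp
next
  case True
  then obtain d where d: "d \<noteq> 0" "\<And>i j. (d $ i + d $ j) * M $ i $ j = 0" by blast
  note edge = skew_diagonal_abs_const(1)[OF assms(2,1) M d(2)]
  have nz: "d $ i \<noteq> 0" for i
    using d(1) skew_diagonal_abs_const(2)[OF assms(2,1) M d(2), of _ i] by (auto simp: vec_eq_iff)
  have diag: "M $ i $ i = 0" for i using d(2)[of i i] nz[of i] by simp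
  fix v :: 'v
  \<comment> \<open>A vector in the kernel of the map is zero once it vanishes at \<open>v\<close>,
    so the map is injective on this hyperplane. Its dimension is one less than
    \<open>CARD('v)\<close>, whence the extra 2 in the bound.\<close>
  let ?H = "{d :: real ^ 'v. axis v 1 \<bullet> d = 0}"
  have "corank M * (corank M + 1) + 2 * dim ?H \<le> 2 * (CARD('v) + card E)"
  proof (rule corank_dimension_count[OF M])
    show "subspace ?H" by (rule subspace_hyperplane)
    fix d' assume "d' \<in> ?H" and d': "\<And>i j. (d' $ i + d' $ j) * M $ i $ j = 0"
    then have "d' $ v = 0" by (simp add: inner_axis')
    then have "d' $ i = 0" for i
      using skew_diagonal_abs_const(2)[OF assms(2,1) M d', of i v] by simp
    then show "d' = 0" by (simp add: vec_eq_iff)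
  qed
  moreover have "dim ?H = CARD('v) - 1"
    by (subst dim_hyperplane) simp_all
  moreover have "CARD('v) \<ge> 1" by (simp add: Suc_le_eq)
  ultimately have "corank M * (corank M + 1) \<le> 2 * card E + 2" by simp
  \<comment> \<open>The signs of \<open>d\<close> give the two sides of the bipartition.\<close>
  moreover have "i \<in> {i. d $ i > 0} \<longleftrightarrow> j \<notin> {i. d $ i > 0}" if "{i, j} \<in> E" for i j
    using edge[OF that] nz[of i] by auto
  ultimately show ?thesis using that(2) diag by blast
qed

section \<open>Corank against the largest eigenvalue\<close>

text \<open>In the first case the larger of \<open>\<mu>\<close> and the corank decides which of the
  two quadratic bounds is used. In the bipartite case the squares of the two factors are bounded
  separately.\<close>

lemma corank_eigenvalue_bound:
  fixes E :: "'v::finite set set"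
  assumes "simple_graph E" "connected_graph E" "card E \<ge> 1"
    and M: "colin_de_verdiere_matrix E M"
    and \<mu>: "eigenvalue (adjacency_matrix E) \<mu>" "\<mu> > 0"
  shows "\<mu> * (real (corank M) + 1) \<le> 2 * real (card E)"
proof -
  define k m where "k = corank M" and "m = card E"
  consider "k * (k + 1) \<le> 2 * m"
    | P where "\<And>i j. {i, j} \<in> E \<Longrightarrow> i \<in> P \<longleftrightarrow> j \<notin> P" "\<And>i. M $ i $ i = 0" "k * (k + 1) \<le> 2 * m + 2"
    using corank_bound_cases[OF assms(1,2) M] unfolding k_def m_def by metis
  then show ?thesis
  proof cases
    case 1
    have mu: "\<mu> * (\<mu> + 1) \<le> 2 * real m"
      unfolding m_def by (rule adjacency_eigenvalue_bound[OF assms(1) \<mu>(1)])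
    have k: "real k * (real k + 1) \<le> 2 * real m"
      using of_nat_mono[OF 1, where ?'a = real] by (simp add: algebra_simps)
    show ?thesis
    proof (cases "\<mu> \<le> real k")
      case True
      then have "\<mu> * (real k + 1) \<le> real k * (real k + 1)" by (intro mult_right_mono) auto
      with k show ?thesis unfolding k_def m_def by linarith
    next
      case False
      then have "\<mu> * (real k + 1) \<le> \<mu> * (\<mu> + 1)" using \<mu>(2) by (intro mult_left_mono) auto
      with mu show ?thesis unfolding k_def m_def by linarith
    qed
  next
    case (2 P)
    have mu: "\<mu>\<^sup>2 \<le> real m"
      unfolding m_def using bipartite_eigenvalue_square_le[OF assms(1) \<mu>(1)] 2(1) by blast
    have "\<not> (k = 2 \<and> m = 2)"
      using path_graph_3_corank_le[OF assms(1,2) _ M 2(2)] unfolding k_def m_def by auto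
    \<comment> \<open>For \<open>k \<ge> 3\<close> it is enough that \<open>k * k \<ge> 5\<close>.
      For \<open>k = 2\<close> the bound needs \<open>m \<ge> 3\<close>, where the hypothesis gives
      only \<open>m \<ge> 2\<close>; hence the exclusion of \<open>k = m = 2\<close>.\<close>
    have "(k + 1)\<^sup>2 \<le> 4 * m"
    proof -
      consider "k = 0" | "k = 1" | "k = 2" | "k \<ge> 3" by linarith
      then show ?thesis
      proof cases
        case 4
        then have "9 \<le> k * k" using mult_le_mono[OF 4 4] by simp
        moreover have "(k + 1)\<^sup>2 = k * k + 2 * k + 1" by (simp add: power2_eq_square)
        moreover have "k * k + k \<le> 2 * m + 2" using 2(3) by simp
        ultimately show ?thesis by linarith
      qed (use 2(3) \<open>\<not> (k = 2 \<and> m = 2)\<close> assms(3) m_def in \<open>auto simp: power2_eq_square\<close>)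
    qed
    then have "(real k + 1)\<^sup>2 \<le> 4 * real m"
      using of_nat_mono[of "(k + 1)\<^sup>2" "4 * m", where ?'a = real] by (simp add: add.commute)
    then have "\<mu>\<^sup>2 * (real k + 1)\<^sup>2 \<le> real m * (4 * real m)"
      using mu by (intro mult_mono) auto
    then have "(\<mu> * (real k + 1))\<^sup>2 \<le> (2 * real m)\<^sup>2"
      by (simp add: power_mult_distrib power2_eq_square mult_ac)
    then show ?thesis unfolding k_def m_def by (rule power2_le_imp_le) simp
  qed
qed

theorem theorem2:
  fixes E :: "'v::finite set set"
    and n m :: nat and \<mu> \<beta> :: real
  assumes "simple_graph E"
    and "connected_graph E"
    and "n = CARD('v)"
    and "m = card E"
    and "m \<ge> 1"
    and "\<mu> = largest_adjacency_eigenvalue E"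
    and "\<beta> = spectral_irregularity E"
  shows "real (colin_de_verdiere E) \<le> real n / \<beta> - 1 \<and>
         real n / \<beta> - 1 = 2 * real m / \<mu> - 1"
proof -
  have \<mu>: "eigenvalue (adjacency_matrix E) \<mu>" "\<mu> > 0"
    using largest_adjacency_eigenvalue_pos[OF assms(1)] assms by simp_all
  obtain M where M: "colin_de_verdiere_matrix E M" "colin_de_verdiere E = corank M"
    by (rule colin_de_verdiere_attained)
  have "\<mu> * (real (colin_de_verdiere E) + 1) \<le> 2 * real m"
    using corank_eigenvalue_bound[OF assms(1,2) _ M(1) \<mu>] M(2) assms(4,5) by simp
  then have "real (colin_de_verdiere E) \<le> 2 * real m / \<mu> - 1"
    using \<mu>(2) by (simp add: field_simps)
  moreover have "real n / \<beta> = 2 * real m / \<mu>"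
    using assms(3-7) \<mu>(2) by (simp add: spectral_irregularity_def field_simps)
  ultimately show ?thesis by simp
qed

end
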